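(* Let $M\in\mathbb{R}^{n\times n}$ and $r\in\mathbb{R}^n$, and suppose that the system $Mx\ge r,\ x\ge 0$ (the constraints of problem (P$_c$)) is feasible. Then the solution set $\mathcal{X}_{\mathrm{LCP}}$ is nonempty if and only if there exists some vector $c\in\mathbb{R}^n$ for which there exists a primal--dual pair $(x^c,y^c)$ of optimal solutions to problems (P$_c$) and (D$_c$), respectively, such that $$x^c_i\le y^c_i,\qquad \forall i\in\{1,2,\dots,n\}.$$
   Context: Given $M\in\mathbb{R}^{n\times n}$ and $r\in\mathbb{R}^n$, the linear complementarity problem (LCP) is to find $x\in\mathbb{R}^n$ with $Mx\ge r$, $x\ge 0$, $x^T(Mx-r)=0$. Its solution set is denoted $\mathcal{X}_{\mathrm{LCP}}$. For $c\in\mathbb{R}^n$, problem (P$_c$) is the linear program $\min\{c^Tx : Mx\ge r,\ x\ge 0\}$ and problem (D$_c$) is its dual $\max\{r^Ty : M^Ty\le c,\ y\ge 0\}$. Vector inequalities are component-wise. *)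

theory Defs
  imports "HOL-Analysis.Analysis"
begin

text \<open>The order on \<^typ>\<open>real ^ 'n\<close> is the library's component-wise order.\<close>

definition lcp_solutions :: "real ^ 'n ^ 'n \<Rightarrow> real ^ 'n \<Rightarrow> (real ^ 'n) set" where
  "lcp_solutions M r = {x. r \<le> M *v x \<and> 0 \<le> x \<and> x \<bullet> (M *v x - r) = 0}"

definition primal_feasible :: "real ^ 'n ^ 'n \<Rightarrow> real ^ 'n \<Rightarrow> (real ^ 'n) set" where
  "primal_feasible M r = {x. r \<le> M *v x \<and> 0 \<le> x}"

definition dual_feasible :: "real ^ 'n ^ 'n \<Rightarrow> real ^ 'n \<Rightarrow> (real ^ 'n) set" where
  "dual_feasible M c = {y. transpose M *v y \<le> c \<and> 0 \<le> y}"

definition primal_optimal ::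
  "real ^ 'n ^ 'n \<Rightarrow> real ^ 'n \<Rightarrow> real ^ 'n \<Rightarrow> real ^ 'n \<Rightarrow> bool" where
  "primal_optimal M r c x \<longleftrightarrow> is_arg_min (\<lambda>x. c \<bullet> x) (\<lambda>x. x \<in> primal_feasible M r) x"

definition dual_optimal ::
  "real ^ 'n ^ 'n \<Rightarrow> real ^ 'n \<Rightarrow> real ^ 'n \<Rightarrow> real ^ 'n \<Rightarrow> bool" where
  "dual_optimal M r c y \<longleftrightarrow> is_arg_max (\<lambda>y. r \<bullet> y) (\<lambda>y. y \<in> dual_feasible M c) y"

end

theory Submission
  imports Defs
begin

text \<open>
  If \<open>x\<close> solves the complementarity problem, then \<open>c = M\<^sup>T x\<close> and \<open>y = x\<close> do the job: \<open>x\<close> is feasible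
  for both programs, and complementarity \<open>x \<bullet> (M x - r) = 0\<close> says exactly that the two objective
  values \<open>c \<bullet> x\<close> and \<open>r \<bullet> x\<close> agree, so that weak duality makes \<open>x\<close> optimal on both sides.

  Conversely, for optimal \<open>x\<close> and \<open>y\<close> strong duality \<open>c \<bullet> x \<le> r \<bullet> y\<close> yields complementary slackness
  \<open>y \<bullet> (M x - r) = 0\<close>. Since \<open>M x - r\<close> is nonnegative, \<open>0 \<le> x \<le> y\<close> squeezes \<open>x \<bullet> (M x - r)\<close> between
  \<open>0\<close> and \<open>y \<bullet> (M x - r) = 0\<close>, so \<open>x\<close> itself solves the complementarity problem.

  Strong duality is derived from Farkas' lemma, which in turn rests on the fact that finitely
  generated cones are closed.
\<close>

section \<open>The nonnegative orthant and Farkas' lemma\<close>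

lemma inner_nonneg_orthant:
  fixes a b :: "'a::ordered_euclidean_space"
  assumes "0 \<le> a" "0 \<le> b"
  shows "0 \<le> a \<bullet> b"
proof -
  have "a \<bullet> b = (\<Sum>i\<in>Basis. (a \<bullet> i) * (b \<bullet> i))"
    by (rule euclidean_inner)
  then show ?thesis
    using assms by (simp add: eucl_le[of "0::'a"] sum_nonneg)
qed

text \<open>The nonnegative orthant is its own dual cone; this is the nontrivial inclusion.\<close>

lemma nonneg_if_inner_nonneg:
  fixes w :: "'a::ordered_euclidean_space"
  assumes "\<And>a. 0 \<le> a \<Longrightarrow> 0 \<le> a \<bullet> w"
  shows "0 \<le> w"
proof -
  have "0 \<le> b \<bullet> w" if "b \<in> Basis" for b
  proof -
    have "0 \<le> b"
      using that by (auto simp: eucl_le[of "0::'a"] inner_Basis)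
    then show ?thesis by (rule assms)
  qed
  then show ?thesis
    by (simp add: eucl_le[of "0::'a"] inner_commute)
qed

lemma orthant_eq_convex_cone_hull_Basis:
  "{z::'a::ordered_euclidean_space. 0 \<le> z} = convex_cone hull Basis"
proof
  show "convex_cone hull Basis \<subseteq> {z::'a. 0 \<le> z}"
  proof (rule hull_minimal)
    show "Basis \<subseteq> {z::'a. 0 \<le> z}"
      by (auto simp: eucl_le[of "0::'a"] inner_Basis)
    show "convex_cone {z::'a. 0 \<le> z}"
      by (simp add: convex_cone_iff scaleR_nonneg_nonneg)
  qed
  have sum_in: "(\<Sum>b\<in>B. g b *\<^sub>R b) \<in> convex_cone hull Basis"
    if "finite B" "B \<subseteq> Basis" "\<And>b. b \<in> B \<Longrightarrow> 0 \<le> g b" for B :: "'a set" and g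
    using that
  proof (induction B rule: finite_induct)
    case empty
    then show ?case by (simp add: convex_cone_hull_contains_0)
  next
    case (insert b B)
    then show ?case
      by (simp add: convex_cone_hull_add convex_cone_hull_mul hull_inc)
  qed
  show "{z::'a. 0 \<le> z} \<subseteq> convex_cone hull Basis"
  proof
    fix z :: 'a
    assume "z \<in> {z. 0 \<le> z}"
    then have "(\<Sum>b\<in>Basis. (z \<bullet> b) *\<^sub>R b) \<in> convex_cone hull Basis"
      by (intro sum_in) (auto simp: eucl_le[of "0::'a"])
    then show "z \<in> convex_cone hull Basis"
      by (simp add: euclidean_representation)
  qed
qed

text \<open>
  Farkas' lemma, for the image of the orthant under a linear map. The image is a cone generated by
  finitely many vectors, hence closed, so a point outside it can be strictly separated from it. On a
  cone the separating functional is bounded below only if it is nonnegative.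
\<close>

lemma farkas:
  fixes f :: "'a::ordered_euclidean_space \<Rightarrow> 'b::euclidean_space"
  assumes "linear f" and "\<nexists>z. 0 \<le> z \<and> f z = v"
  obtains d where "\<And>z. 0 \<le> z \<Longrightarrow> 0 \<le> d \<bullet> f z" "d \<bullet> v < 0"
proof -
  let ?K = "f ` {z. 0 \<le> z}"
  have K: "?K = convex_cone hull (f ` Basis)"
    using convex_cone_hull_linear_image[OF assms(1), of Basis]
    by (simp add: orthant_eq_convex_cone_hull_Basis)
  have "closed ?K" "convex ?K"
    unfolding K by (auto intro: closed_convex_cone_hull convex_convex_cone_hull)
  moreover have "v \<notin> ?K"
    using assms(2) by auto
  ultimately obtain d \<beta> where d: "d \<bullet> v < \<beta>" "\<And>k. k \<in> ?K \<Longrightarrow> \<beta> < d \<bullet> k"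
    using separating_hyperplane_closed_point by metis
  have "\<beta> < 0"
    using d(2)[of "f 0"] linear_0[OF assms(1)] by auto
  show thesis
  proof
    show "d \<bullet> v < 0"
      using d(1) \<open>\<beta> < 0\<close> by linarith
    show "0 \<le> d \<bullet> f z" if "0 \<le> z" for z
    proof (rule ccontr)
      assume neg: "\<not> 0 \<le> d \<bullet> f z"
      \<comment> \<open>Rescale \<open>z\<close> so that the functional takes exactly the forbidden value \<open>\<beta>\<close>.\<close>
      define t where "t = \<beta> / (d \<bullet> f z)"
      have "0 \<le> t"
        using neg \<open>\<beta> < 0\<close> by (simp add: t_def divide_nonpos_nonpos)
      then have "\<beta> < d \<bullet> f (t *\<^sub>R z)"
        using d(2) that by (simp add: scaleR_nonneg_nonneg)
      also have "d \<bullet> f (t *\<^sub>R z) = \<beta>"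
        using neg by (simp add: t_def linear_scale[OF assms(1)])
      finally show False by simp
    qed
  qed
qed

section \<open>Linear programming duality\<close>

lemma inner_transpose_mult:
  fixes M :: "real ^ 'n ^ 'm"
  shows "(transpose M *v y) \<bullet> x = y \<bullet> (M *v x)"
  by (simp add: dot_lmul_matrix)

lemma lp_weak_duality:
  fixes M :: "real ^ 'n ^ 'm"
  assumes "r \<le> M *v x" "0 \<le> x" "transpose M *v y \<le> c" "0 \<le> y"
  shows "r \<bullet> y \<le> y \<bullet> (M *v x)" "y \<bullet> (M *v x) \<le> c \<bullet> x"
proof -
  have "0 \<le> y \<bullet> (M *v x - r)" "0 \<le> x \<bullet> (c - transpose M *v y)"
    by (rule inner_nonneg_orthant; use assms in simp)+
  then show "r \<bullet> y \<le> y \<bullet> (M *v x)" "y \<bullet> (M *v x) \<le> c \<bullet> x"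
    using inner_transpose_mult[of M y x]
    by (simp_all add: inner_diff_right inner_commute)
qed

text \<open>
  Strong duality. Write the wanted dual point with slack variables as
  \<open>M\<^sup>T y + s = c\<close>, \<open>r \<bullet> y - t = c \<bullet> x\<close>, \<open>y, s, t \<ge> 0\<close>. If this system has no solution, Farkas' lemma
  gives \<open>(u, \<tau>)\<close> with \<open>u \<ge> 0\<close>, \<open>\<tau> \<le> 0\<close>, \<open>M u \<ge> - \<tau> r\<close> and \<open>c \<bullet> u < - \<tau> (c \<bullet> x)\<close>. For \<open>\<tau> < 0\<close> the
  point \<open>u / (- \<tau>)\<close> is feasible and cheaper than \<open>x\<close>; for \<open>\<tau> = 0\<close> the vector \<open>u\<close> is a recession
  direction of decreasing cost, and \<open>x + u\<close> is feasible and cheaper than \<open>x\<close>.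
\<close>

lemma lp_strong_duality:
  fixes M :: "real ^ 'n ^ 'm"
  assumes feas: "r \<le> M *v x" "0 \<le> x"
    and opt: "\<And>x'. r \<le> M *v x' \<Longrightarrow> 0 \<le> x' \<Longrightarrow> c \<bullet> x \<le> c \<bullet> x'"
  obtains y where "transpose M *v y \<le> c" "0 \<le> y" "c \<bullet> x \<le> r \<bullet> y"
proof -
  define f where "f = (\<lambda>(y, s, t). (transpose M *v y + s, r \<bullet> y - t))"
  have lin: "linear (f :: (real^'m) \<times> (real^'n) \<times> real \<Rightarrow> (real^'n) \<times> real)"
    by (rule linearI)
      (auto simp: f_def matrix_vector_right_distrib matrix_vector_mult_scaleR scaleR_add_right
        inner_add_right right_diff_distrib simp del: transpose_matrix_vector)
  have "\<exists>z. 0 \<le> z \<and> f z = (c, c \<bullet> x)"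
  proof (rule ccontr)
    assume "\<nexists>z. 0 \<le> z \<and> f z = (c, c \<bullet> x)"
    then obtain d where
      d: "\<And>z. 0 \<le> z \<Longrightarrow> 0 \<le> d \<bullet> f z" "d \<bullet> (c, c \<bullet> x) < 0"
      by (rule farkas[OF lin]) blast
    obtain u \<tau> where u: "d = (u, \<tau>)" by (cases d)
    have dual: "0 \<le> u \<bullet> (transpose M *v y + s) + \<tau> * (r \<bullet> y - t)"
      if "0 \<le> y" "0 \<le> s" "0 \<le> t" for y s t
      using d(1)[of "(y, s, t)"] that by (simp add: f_def u zero_prod_def)
    have "0 \<le> u"
    proof (rule nonneg_if_inner_nonneg)
      show "0 \<le> s \<bullet> u" if "0 \<le> s" for s
        using dual[of 0 s 0] that by (simp add: inner_commute)
    qed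
    have "\<tau> \<le> 0"
      using dual[of 0 0 1] by simp
    have "0 \<le> M *v u + \<tau> *\<^sub>R r"
    proof (rule nonneg_if_inner_nonneg)
      show "0 \<le> y \<bullet> (M *v u + \<tau> *\<^sub>R r)" if "0 \<le> y" for y
        using dual[of y 0 0] that inner_transpose_mult[of M y u]
        by (simp add: inner_add_right inner_commute)
    qed
    have cost: "c \<bullet> u + \<tau> * (c \<bullet> x) < 0"
      using d(2) by (simp add: u inner_commute)
    show False
    proof (cases "\<tau> = 0")
      case True
      have "r + 0 \<le> M *v x + M *v u"
        by (rule add_mono) (use feas(1) \<open>0 \<le> M *v u + \<tau> *\<^sub>R r\<close> True in simp_all)
      then have "r \<le> M *v (x + u)"
        by (simp add: matrix_vector_right_distrib)
      then have "c \<bullet> x \<le> c \<bullet> (x + u)"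
        by (rule opt) (simp add: feas \<open>0 \<le> u\<close>)
      then show False
        using cost True by (simp add: inner_add_right)
    next
      case False
      define a where "a = inverse (- \<tau>)"
      have "0 < a" and a: "a * \<tau> = - 1"
        using False \<open>\<tau> \<le> 0\<close> by (auto simp: a_def)
      have "0 \<le> a *\<^sub>R (M *v u + \<tau> *\<^sub>R r)"
        using \<open>0 < a\<close> \<open>0 \<le> M *v u + \<tau> *\<^sub>R r\<close> by (intro scaleR_nonneg_nonneg) auto
      then have "r \<le> M *v (a *\<^sub>R u)"
        by (simp add: scaleR_add_right a matrix_vector_mult_scaleR)
      then have "c \<bullet> x \<le> c \<bullet> (a *\<^sub>R u)"
        by (rule opt) (use \<open>0 < a\<close> \<open>0 \<le> u\<close> in \<open>simp add: scaleR_nonneg_nonneg\<close>)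
      moreover have "a * (c \<bullet> u + \<tau> * (c \<bullet> x)) < 0"
        using \<open>0 < a\<close> cost by (rule mult_pos_neg)
      ultimately show False
        using a by (simp add: distrib_left flip: mult.assoc)
    qed
  qed
  then obtain y s t where "0 \<le> y" "0 \<le> s" "0 \<le> t"
    and y: "transpose M *v y + s = c" "r \<bullet> y - t = c \<bullet> x"
    by (auto simp: f_def zero_prod_def simp del: transpose_matrix_vector)
  show thesis
  proof
    show "transpose M *v y \<le> c"
      unfolding y(1)[symmetric] using \<open>0 \<le> s\<close> by simp
    show "c \<bullet> x \<le> r \<bullet> y"
      using y(2) \<open>0 \<le> t\<close> by linarith
  qed fact
qed

section \<open>Complementarity solutions and optimal pairs\<close>

lemma primal_optimal_iff:
  "primal_optimal M r c x \<longleftrightarrow>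
    r \<le> M *v x \<and> 0 \<le> x \<and> (\<forall>x'. r \<le> M *v x' \<longrightarrow> 0 \<le> x' \<longrightarrow> c \<bullet> x \<le> c \<bullet> x')"
  by (auto simp: primal_optimal_def is_arg_min_linorder primal_feasible_def)

lemma dual_optimal_iff:
  "dual_optimal M r c y \<longleftrightarrow>
    transpose M *v y \<le> c \<and> 0 \<le> y \<and> (\<forall>y'. transpose M *v y' \<le> c \<longrightarrow> 0 \<le> y' \<longrightarrow> r \<bullet> y' \<le> r \<bullet> y)"
  by (auto simp: dual_optimal_def is_arg_max_linorder dual_feasible_def)

lemma lcp_solution_optimal:
  assumes "x \<in> lcp_solutions M r"
  shows "primal_optimal M r (transpose M *v x) x" "dual_optimal M r (transpose M *v x) x"
proof -
  have x: "r \<le> M *v x" "0 \<le> x" and eq: "x \<bullet> (M *v x) = r \<bullet> x"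
    using assms by (auto simp: lcp_solutions_def inner_diff_right inner_commute)
  let ?c = "transpose M *v x"
  have value_eq: "?c \<bullet> x = r \<bullet> x"
    using inner_transpose_mult[of M x x] eq by simp
  show "primal_optimal M r ?c x"
    unfolding primal_optimal_iff value_eq
  proof (intro conjI allI impI x)
    show "r \<bullet> x \<le> ?c \<bullet> x'" if "r \<le> M *v x'" "0 \<le> x'" for x'
      using lp_weak_duality[OF that order_refl x(2)] by linarith
  qed
  show "dual_optimal M r ?c x"
    unfolding dual_optimal_iff value_eq[symmetric]
  proof (intro conjI allI impI x order_refl)
    show "r \<bullet> y \<le> ?c \<bullet> x" if "transpose M *v y \<le> ?c" "0 \<le> y" for y
      using lp_weak_duality[OF x that] by linarith
  qed
qed

lemma complementary_slackness:
  assumes "primal_optimal M r c x" "dual_optimal M r c y"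
  shows "y \<bullet> (M *v x - r) = 0"
proof -
  have x: "r \<le> M *v x" "0 \<le> x"
    and xopt: "\<And>x'. r \<le> M *v x' \<Longrightarrow> 0 \<le> x' \<Longrightarrow> c \<bullet> x \<le> c \<bullet> x'"
    using assms(1) by (auto simp: primal_optimal_iff)
  have y: "transpose M *v y \<le> c" "0 \<le> y"
    and yopt: "\<And>y'. transpose M *v y' \<le> c \<Longrightarrow> 0 \<le> y' \<Longrightarrow> r \<bullet> y' \<le> r \<bullet> y"
    using assms(2) by (auto simp: dual_optimal_iff)
  obtain y' where "transpose M *v y' \<le> c" "0 \<le> y'" "c \<bullet> x \<le> r \<bullet> y'"
    by (rule lp_strong_duality[OF x xopt])
  then have "c \<bullet> x \<le> r \<bullet> y"
    using yopt[of y'] by linarith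
  then show ?thesis
    using lp_weak_duality[OF x y] by (simp add: inner_diff_right inner_commute)
qed

theorem theorem2p1:
  fixes M :: "real ^ 'n ^ 'n" and r :: "real ^ 'n"
  assumes "primal_feasible M r \<noteq> {}"
  shows "lcp_solutions M r \<noteq> {} \<longleftrightarrow>
    (\<exists>c x y. primal_optimal M r c x \<and> dual_optimal M r c y \<and> (\<forall>i. x $ i \<le> y $ i))"
proof
  assume "lcp_solutions M r \<noteq> {}"
  then obtain x where "x \<in> lcp_solutions M r" by blast
  from lcp_solution_optimal[OF this]
  show "\<exists>c x y. primal_optimal M r c x \<and> dual_optimal M r c y \<and> (\<forall>i. x $ i \<le> y $ i)"
    by blast
next
  assume "\<exists>c x y. primal_optimal M r c x \<and> dual_optimal M r c y \<and> (\<forall>i. x $ i \<le> y $ i)"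
  then obtain c x y where opt: "primal_optimal M r c x" "dual_optimal M r c y" and "x \<le> y"
    by (auto simp: less_eq_vec_def)
  have x: "r \<le> M *v x" "0 \<le> x"
    using opt(1) by (auto simp: primal_optimal_iff)
  have "0 \<le> x \<bullet> (M *v x - r)" "0 \<le> (y - x) \<bullet> (M *v x - r)"
    by (rule inner_nonneg_orthant; use x \<open>x \<le> y\<close> in simp)+
  with complementary_slackness[OF opt] have "x \<bullet> (M *v x - r) = 0"
    by (simp add: inner_diff_left)
  with x have "x \<in> lcp_solutions M r"
    by (simp add: lcp_solutions_def)
  then show "lcp_solutions M r \<noteq> {}" by blast
qed

end
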